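(* Let $\mathbf m,\mathbf n$ be two strictly increasing sequences of positive integers such that the difference set $\Delta_{\mathbf m,\mathbf n}$ is finite. Then a basis $\mathcal B$ of a Banach space is ($\mathbf n$, strong partially greedy) if and only if it is ($\mathbf m$, strong partially greedy).
   Context: The sequences $\mathbf m,\mathbf n$ are identified with their sets of terms, and $\Delta_{\mathbf m,\mathbf n}=\{i:i\in\mathbf m,i\notin\mathbf n\}\cup\{i:i\in\mathbf n,i\notin\mathbf m\}$ is their symmetric difference. Banach spaces are separable, infinite-dimensional, over $\mathbb F=\mathbb R$ or $\mathbb C$; $\mathbb N=\{1,2,\dots\}$. A basis of $X$ is a sequence $\mathcal B=(e_n)_{n\ge1}\subset X$ whose linear span is norm-dense and for which there is a sequence $(e_n^* )_{n\ge1}\subset X^*$ with $e_j^*(e_k)=\delta_{j,k}$ and $0<\inf_n\{\|e_n\|,\|e_n^*\|\}\le\sup_n\{\|e_n\|,\|e_n^*\|\}<\infty$ (then $e_n^*(x)\to0$ for every $x$). For a finite set $A\subset\mathbb N$, $P_A(x)=\sum_{n\in A}e_n^*(x)e_n$. For $x\in X$, $m\in\mathbb N$, a greedy set of $x$ of order $m$ is a set $A\subset\mathbb N$ with $|A|=m$ and $\min_{n\in A}|e_n^*(x)|\ge\max_{n\notin A}|e_n^*(x)|$; $G_m(x)$ denotes $P_A(x)$ for such an $A$ (not necessarily unique). For $\mathbf n=(n_k)_{k\ge1}$ put $P^{\mathbf n}_0(x)=0$, $P^{\mathbf n}_k(x)=\sum_{i=1}^k e_{n_i}^*(x)e_{n_i}$,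 and $\widehat\sigma^{\mathbf n}_m(x)=\min_{0\le k\le m}\|x-P^{\mathbf n}_k(x)\|$. $\mathcal B$ is ($\mathbf n$, strong partially greedy) if there is $C\ge1$ with $\|x-G_m(x)\|\le C\,\widehat\sigma^{\mathbf n}_m(x)$ for all $x\in X$, $m\in\mathbb N$ and all choices of $G_m(x)$ (and likewise for $\mathbf m$). *)

theory Defs
  imports "HOL-Analysis.Analysis"
begin

text \<open>
  Scalars are an arbitrary type of class \<open>real_normed_field\<close>. Both \<open>real\<close> and \<open>complex\<close> are
  instances, and up to isometric isomorphism they are the only ones (Gelfand--Mazur). The class
  \<open>banach\<close> only supplies real scalar multiplication, so the multiplication by the scalar field is
  a parameter that has to be compatible with it.
\<close>

locale banach_over = vector_space smul
  for smul :: "'k::real_normed_field \<Rightarrow> 'a::banach \<Rightarrow> 'a" +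
  assumes scale_of_real: "smul (of_real r) x = r *\<^sub>R x"
    and norm_scale: "norm (smul c x) = norm c * norm x"
    and separable: "\<exists>D::'a set. countable D \<and> closure D = UNIV"
    and infinite_dimensional: "\<nexists>B. finite B \<and> module.span smul B = UNIV"

definition dual :: "('k::real_normed_field \<Rightarrow> 'a::banach \<Rightarrow> 'a) \<Rightarrow> ('a \<Rightarrow> 'k) set" where
  "dual smul = {f. bounded_linear f \<and> (\<forall>c x. f (smul c x) = c * f x)}"

text \<open>
  All sequences are indexed by the positive integers: values at index \<open>0\<close> are never used.
  The functionals \<open>es\<close> biorthogonal to \<open>e\<close> are uniquely determined by \<open>e\<close>, because
  the span of \<open>e\<close> is dense; they are carried along as an explicit argument.
\<close>

definition is_basis ::
  "('k::real_normed_field \<Rightarrow> 'a::banach \<Rightarrow> 'a) \<Rightarrow> (nat \<Rightarrow> 'a) \<Rightarrow> (nat \<Rightarrow> 'a \<Rightarrow> 'k) \<Rightarrow> bool" where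
  "is_basis smul e es \<longleftrightarrow>
     closure (module.span smul (e ` {1..})) = UNIV \<and>
     (\<forall>n\<ge>1. es n \<in> dual smul) \<and>
     (\<forall>j\<ge>1. \<forall>k\<ge>1. es j (e k) = (if j = k then 1 else 0)) \<and>
     (let S = (\<lambda>n. norm (e n)) ` {1..} \<union> (\<lambda>n. onorm (es n)) ` {1..}
      in 0 < Inf S \<and> bdd_above S)"

definition coord_proj ::
  "('k::real_normed_field \<Rightarrow> 'a::banach \<Rightarrow> 'a) \<Rightarrow> (nat \<Rightarrow> 'a) \<Rightarrow> (nat \<Rightarrow> 'a \<Rightarrow> 'k) \<Rightarrow>
   nat set \<Rightarrow> 'a \<Rightarrow> 'a" where
  "coord_proj smul e es A x = (\<Sum>n\<in>A. smul (es n x) (e n))"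

definition greedy_set :: "(nat \<Rightarrow> 'a::banach \<Rightarrow> 'k::real_normed_field) \<Rightarrow> 'a \<Rightarrow> nat \<Rightarrow> nat set \<Rightarrow> bool" where
  "greedy_set es x m A \<longleftrightarrow>
     A \<subseteq> {1..} \<and> finite A \<and> card A = m \<and>
     (\<forall>n\<in>A. \<forall>k\<in>{1..} - A. norm (es n x) \<ge> norm (es k x))"

definition partial_sum ::
  "('k::real_normed_field \<Rightarrow> 'a::banach \<Rightarrow> 'a) \<Rightarrow> (nat \<Rightarrow> 'a) \<Rightarrow> (nat \<Rightarrow> 'a \<Rightarrow> 'k) \<Rightarrow>
   (nat \<Rightarrow> nat) \<Rightarrow> nat \<Rightarrow> 'a \<Rightarrow> 'a" where
  "partial_sum smul e es ns k x = (\<Sum>i=1..k. smul (es (ns i) x) (e (ns i)))"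

definition sigma_hat ::
  "('k::real_normed_field \<Rightarrow> 'a::banach \<Rightarrow> 'a) \<Rightarrow> (nat \<Rightarrow> 'a) \<Rightarrow> (nat \<Rightarrow> 'a \<Rightarrow> 'k) \<Rightarrow>
   (nat \<Rightarrow> nat) \<Rightarrow> nat \<Rightarrow> 'a \<Rightarrow> real" where
  "sigma_hat smul e es ns m x = Min ((\<lambda>k. norm (x - partial_sum smul e es ns k x)) ` {0..m})"

definition strong_partially_greedy ::
  "('k::real_normed_field \<Rightarrow> 'a::banach \<Rightarrow> 'a) \<Rightarrow> (nat \<Rightarrow> 'a) \<Rightarrow> (nat \<Rightarrow> 'a \<Rightarrow> 'k) \<Rightarrow>
   (nat \<Rightarrow> nat) \<Rightarrow> bool" where
  "strong_partially_greedy smul e es ns \<longleftrightarrow>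
     (\<exists>C\<ge>1. \<forall>x. \<forall>m\<ge>1. \<forall>A. greedy_set es x m A \<longrightarrow>
        norm (x - coord_proj smul e es A x) \<le> C * sigma_hat smul e es ns m x)"

definition increasing_pos_seq :: "(nat \<Rightarrow> nat) \<Rightarrow> bool" where
  "increasing_pos_seq ns \<longleftrightarrow> strict_mono_on {1..} ns \<and> (\<forall>i\<ge>1. ns i \<ge> 1)"

definition difference_set :: "(nat \<Rightarrow> nat) \<Rightarrow> (nat \<Rightarrow> nat) \<Rightarrow> nat set" where
  "difference_set ms ns = (ms ` {1..} - ns ` {1..}) \<union> (ns ` {1..} - ms ` {1..})"

end

theory Submission
  imports Defs
begin

text \<open>
  By symmetry it is enough to pass from \<open>ns\<close> to \<open>ms\<close>. Fix \<open>k\<close> and let \<open>S\<close> and \<open>T\<close> be the sets of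
  the first \<open>k\<close> terms of \<open>ms\<close> and of \<open>ns\<close>. They have the same cardinality, and their differences
  \<open>E = S - T\<close> and \<open>F = T - S\<close> have at most as many elements as the difference set of the two
  sequences (\<open>card_initial_segment_diff_le\<close>). So only boundedly many coordinates have to be
  corrected, and the point is to correct only coordinates that are controlled by
  \<open>R = norm (x - P S x)\<close>, where \<open>P\<close> denotes the coordinate projections.

  Let \<open>A\<close> be a greedy set of \<open>x\<close> with at least \<open>k\<close> elements. Either \<open>A = S\<close>, and there is nothing
  to prove, or \<open>A\<close> has an element \<open>p\<close> outside \<open>S\<close>. The \<open>p\<close>-th coordinate of \<open>x\<close> is also a coordinate
  of \<open>x - P S x\<close>, hence at most a constant times \<open>R\<close>. By greediness the same bound holds for the least
  modulus \<open>t\<close> of the coordinates in \<open>A\<close> and for all coordinates outside \<open>A\<close>. The coordinates in \<open>E\<close>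
  may be large, so they are deleted from \<open>x\<close>. This costs \<open>A\<close> some elements, for which it is
  compensated by a set \<open>G\<close> of fresh indices, where the coordinates are replaced by \<open>t\<close>. In the
  resulting vector \<open>y\<close> the set \<open>(A - E) \<union> G\<close> is greedy and has at least \<open>k\<close> elements, so the
  hypothesis on \<open>ns\<close> compares its residual with \<open>norm (y - P T y)\<close>. Both quantities differ from those
  for \<open>x\<close>, \<open>A\<close> and \<open>S\<close> by boundedly many terms of norm at most a constant times \<open>R\<close>
  (\<open>greedy_bound_transfer\<close>).
\<close>

section \<open>Initial segments of almost equal sequences\<close>

lemma strict_mono_on_le_iff:
  fixes f :: "nat \<Rightarrow> nat"
  assumes "strict_mono_on I f" "i \<in> I" "j \<in> I"
  shows "f i \<le> f j \<longleftrightarrow> i \<le> j"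
  using assms by (metis linorder_not_less order_less_imp_le strict_mono_onD order_le_less)

lemma card_initial_segment:
  assumes "increasing_pos_seq ms"
  shows "card (ms ` {1..k}) = k"
proof -
  have "inj_on ms {1..k}"
    using assms strict_mono_on_imp_inj_on[of "{1..}" ms]
    by (auto simp: increasing_pos_seq_def intro: inj_on_subset)
  then show ?thesis by (simp add: card_image)
qed

lemma initial_segment_diff_subset:
  assumes "increasing_pos_seq ns" "k \<ge> 1" "ms k \<le> ns k" "increasing_pos_seq ms"
  shows "ms ` {1..k} - ns ` {1..k} \<subseteq> difference_set ms ns"
proof
  fix i assume i: "i \<in> ms ` {1..k} - ns ` {1..k}"
  then obtain r where r: "r \<in> {1..k}" "i = ms r" by blast
  have "ms r \<le> ms k"
    using r assms strict_mono_on_le_iff[of "{1..}" ms r k] by (auto simp: increasing_pos_seq_def)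
  then have "i \<le> ns k" using r assms by simp
  have "i \<notin> ns ` {1..}"
  proof
    assume "i \<in> ns ` {1..}"
    then obtain s where s: "s \<ge> 1" "i = ns s" by auto
    with \<open>i \<le> ns k\<close> have "s \<le> k"
      using assms strict_mono_on_le_iff[of "{1..}" ns s k] by (auto simp: increasing_pos_seq_def)
    with s i show False by auto
  qed
  with r show "i \<in> difference_set ms ns" by (auto simp: difference_set_def)
qed

text \<open>
  Of the two segments, the one with the smaller last term can leave the other one only through the
  difference set; as the segments have the same cardinality, so do their two differences.
\<close>

lemma card_initial_segment_diff_le:
  assumes "increasing_pos_seq ms" "increasing_pos_seq ns" "finite (difference_set ms ns)"
  shows "card (ms ` {1..k} - ns ` {1..k}) \<le> card (difference_set ms ns)"
proof (cases "k = 0")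
  case False
  show ?thesis
  proof (cases "ms k \<le> ns k")
    case True
    then show ?thesis
      using False assms by (intro card_mono initial_segment_diff_subset) auto
  next
    case False
    then have "ns ` {1..k} - ms ` {1..k} \<subseteq> difference_set ns ms"
      using \<open>k \<noteq> 0\<close> assms by (intro initial_segment_diff_subset) auto
    also have "difference_set ns ms = difference_set ms ns"
      by (auto simp: difference_set_def)
    finally have "card (ns ` {1..k} - ms ` {1..k}) \<le> card (difference_set ms ns)"
      using assms(3) card_mono by blast
    moreover have "card (ms ` {1..k} - ns ` {1..k}) = card (ns ` {1..k} - ms ` {1..k})"
      using card_initial_segment[OF assms(1), of k] card_initial_segment[OF assms(2), of k]
      by (intro antisym card_le_sym_Diff) simp_all
    ultimately show ?thesis by simp
  qed
qed simp

lemma partial_sum_eq_coord_proj: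
  assumes "increasing_pos_seq ns"
  shows "partial_sum smul e es ns k x = coord_proj smul e es (ns ` {1..k}) x"
proof -
  have "inj_on ns {1..k}"
    using assms strict_mono_on_imp_inj_on[of "{1..}" ns]
    by (auto simp: increasing_pos_seq_def intro: inj_on_subset)
  then show ?thesis by (simp add: partial_sum_def coord_proj_def sum.reindex)
qed

text \<open>
  Unfolding the minimum in \<open>sigma_hat\<close> leaves one inequality for each \<open>k\<close>, and the transfer between
  the two sequences can be done for each \<open>k\<close> separately.
\<close>

lemma strong_partially_greedy_iff:
  assumes "increasing_pos_seq ns"
  shows "strong_partially_greedy smul e es ns \<longleftrightarrow>
    (\<exists>C\<ge>1. \<forall>x. \<forall>m\<ge>1. \<forall>A. greedy_set es x m A \<longrightarrow> (\<forall>k\<le>m.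
       norm (x - coord_proj smul e es A x) \<le> C * norm (x - coord_proj smul e es (ns ` {1..k}) x)))"
proof -
  have "norm (x - coord_proj smul e es A x) \<le> C * sigma_hat smul e es ns m x \<longleftrightarrow>
      (\<forall>k\<le>m. norm (x - coord_proj smul e es A x)
        \<le> C * norm (x - coord_proj smul e es (ns ` {1..k}) x))" if "C \<ge> 1" for C x m A
  proof -
    have "norm (x - coord_proj smul e es A x) / C \<le> sigma_hat smul e es ns m x \<longleftrightarrow>
      (\<forall>k\<le>m. norm (x - coord_proj smul e es A x) / C
        \<le> norm (x - coord_proj smul e es (ns ` {1..k}) x))"
      unfolding sigma_hat_def
      by (subst Min_ge_iff) (auto simp: partial_sum_eq_coord_proj[OF assms])
    then show ?thesis using that by (simp add: pos_divide_le_eq mult.commute)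
  qed
  then show ?thesis unfolding strong_partially_greedy_def by (metis (no_types, lifting))
qed

section \<open>Greedy residuals under a change of boundedly many indices\<close>

text \<open>
  What the argument needs of a basis: biorthogonal functionals, and one constant \<open>a\<close> bounding the
  norms of both the vectors and the functionals.
\<close>

locale bounded_biorthogonal = vector_space smul
  for smul :: "'k::real_normed_field \<Rightarrow> 'a::banach \<Rightarrow> 'a" +
  fixes e :: "nat \<Rightarrow> 'a" and es :: "nat \<Rightarrow> 'a \<Rightarrow> 'k" and a :: real
  assumes norm_smul: "norm (smul c x) = norm c * norm x"
    and es_add: "n \<ge> 1 \<Longrightarrow> es n (x + y) = es n x + es n y"
    and es_smul: "n \<ge> 1 \<Longrightarrow> es n (smul c x) = c * es n x"
    and es_e: "j \<ge> 1 \<Longrightarrow> k \<ge> 1 \<Longrightarrow> es j (e k) = (if j = k then 1 else 0)"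
    and norm_e_le: "n \<ge> 1 \<Longrightarrow> norm (e n) \<le> a"
    and norm_es_le: "n \<ge> 1 \<Longrightarrow> norm (es n x) \<le> a * norm x"
begin

abbreviation P :: "nat set \<Rightarrow> 'a \<Rightarrow> 'a" where
  "P A x \<equiv> \<Sum>n\<in>A. smul (es n x) (e n)"

lemma a_nonneg: "a \<ge> 0"
  using norm_e_le[of 1] norm_ge_zero[of "e 1"] by linarith

lemma es_combination:
  assumes "finite A" "A \<subseteq> {1..}" "j \<ge> 1"
  shows "es j (\<Sum>n\<in>A. smul (c n) (e n)) = (if j \<in> A then c j else 0)"
  using assms
proof (induction A rule: finite_induct)
  case empty
  show ?case using es_smul[of j 0 0] \<open>j \<ge> 1\<close> by simp
next
  case (insert n A)
  then show ?case by (auto simp: es_add es_smul es_e)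
qed

lemma es_diff: "n \<ge> 1 \<Longrightarrow> es n (x - y) = es n x - es n y"
  using es_add[of n "x - y" y] by simp

lemma norm_es_le_residual:
  assumes "finite S" "S \<subseteq> {1..}" "i \<ge> 1" "i \<notin> S"
  shows "norm (es i x) \<le> a * norm (x - P S x)"
  using norm_es_le[of i "x - P S x"] assms by (simp add: es_diff es_combination)

lemma norm_combination_le:
  assumes "A \<subseteq> {1..}" "\<And>n. n \<in> A \<Longrightarrow> norm (c n) \<le> b"
  shows "norm (\<Sum>n\<in>A. smul (c n) (e n)) \<le> real (card A) * (b * a)"
proof (rule order_trans[OF norm_sum sum_bounded_above])
  fix n assume "n \<in> A"
  then show "norm (smul (c n) (e n)) \<le> b * a"
    unfolding norm_smul using assms norm_e_le[of n]
    by (intro mult_mono) (auto intro: order_trans[OF norm_ge_zero])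
qed

text \<open>
  The vector \<open>y\<close> and the set \<open>(A - E) \<union> G\<close> described above: after the deletion of the coordinates in
  \<open>E\<close>, any fresh index may enter the greedy set once its coordinate has the threshold modulus \<open>t\<close>.
\<close>

lemma greedy_set_replace:
  assumes A: "greedy_set es x m A"
    and E: "finite E" "E \<subseteq> {1..}" and G: "finite G" "G \<subseteq> {1..}" "G \<inter> (A \<union> E) = {}"
    and t: "t \<ge> 0" "\<And>n. n \<in> A \<Longrightarrow> t \<le> norm (es n x)"
      "\<And>n. n \<in> {1..} - A \<Longrightarrow> norm (es n x) \<le> t"
  defines "y \<equiv> x - P (E \<union> G) x + (\<Sum>n\<in>G. smul (of_real t) (e n))"
  shows "greedy_set es y (card ((A - E) \<union> G)) ((A - E) \<union> G)"
    and "\<And>i. i \<ge> 1 \<Longrightarrow> es i y = (if i \<in> G then of_real t else if i \<in> E then 0 else es i x)"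
proof -
  show coord: "es i y = (if i \<in> G then of_real t else if i \<in> E then 0 else es i x)"
    if "i \<ge> 1" for i
    using that E G unfolding y_def by (auto simp: es_add es_diff es_combination)
  have fin: "finite A" "A \<subseteq> {1..}"
    using A by (auto simp: greedy_set_def)
  have large: "t \<le> norm (es i y)" if "i \<in> (A - E) \<union> G" for i
    using that t G fin by (subst coord) auto
  have small: "norm (es i y) \<le> t" if "i \<in> {1..} - ((A - E) \<union> G)" for i
    using that t by (subst coord) auto
  show "greedy_set es y (card ((A - E) \<union> G)) ((A - E) \<union> G)"
    unfolding greedy_set_def
  proof (intro conjI ballI)
    fix i k assume "i \<in> (A - E) \<union> G" "k \<in> {1..} - ((A - E) \<union> G)"
    then show "norm (es k y) \<le> norm (es i y)"
      using large small by (blast intro: order_trans)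
  qed (use fin G in auto)
qed

text \<open>
  The comparison of \<open>x\<close>, \<open>A\<close>, \<open>S\<close> with \<open>y\<close>, \<open>(A - E) \<union> G\<close>, \<open>T\<close>. The residual of \<open>y\<close> differs from
  that of \<open>x\<close> by the coordinates in \<open>E - A\<close> and \<open>G\<close>, all of them outside \<open>A\<close> and so of modulus at
  most \<open>t\<close>. In \<open>y - P T y\<close> the indices in \<open>E \<union> T = S \<union> F\<close> are removed from \<open>x\<close>, so that it differs
  from \<open>x - P S x\<close> only by the coordinates in \<open>F\<close>, which survive in \<open>x - P S x\<close>, and by the old and
  the new coordinates in \<open>G\<close>. This makes two correction terms outside and three inside the factor
  \<open>C\<close>, each bounded by \<open>d * a\<^sup>2 * R\<close>; the summand \<open>1\<close> in the constant covers the case \<open>A = S\<close>.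
\<close>

lemma greedy_bound_transfer:
  assumes S: "finite S" "S \<subseteq> {1..}" and T: "finite T" "T \<subseteq> {1..}"
    and ST: "card S = card T" "card (S - T) \<le> d"
    and C: "C \<ge> 0"
    and bound: "\<And>y m A. greedy_set es y m A \<Longrightarrow> m \<ge> 1 \<Longrightarrow> card T \<le> m \<Longrightarrow>
      norm (y - P A y) \<le> C * norm (y - P T y)"
    and A: "greedy_set es x m A" "m \<ge> 1" "card S \<le> m"
  shows "norm (x - P A x) \<le> (1 + C * (1 + 3 * real d * a\<^sup>2) + 2 * real d * a\<^sup>2) * norm (x - P S x)"
proof (cases "A \<subseteq> S")
  case True
  then have "A = S"
    using A S by (intro card_seteq) (auto simp: greedy_set_def)
  moreover have "1 * norm (x - P S x)
      \<le> (1 + C * (1 + 3 * real d * a\<^sup>2) + 2 * real d * a\<^sup>2) * norm (x - P S x)"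
    using C by (intro mult_right_mono) auto
  ultimately show ?thesis by simp
next
  case False
  define R where "R = norm (x - P S x)"
  define E where "E = S - T"
  define F where "F = T - S"
  have finA: "finite A" "A \<subseteq> {1..}" "card A = m" "A \<noteq> {}"
    using A by (auto simp: greedy_set_def)
  have finE: "finite E" "E \<subseteq> {1..}" and finF: "finite F" "F \<subseteq> {1..}"
    using S T by (auto simp: E_def F_def)
  have cardF: "card F \<le> d" and cardE: "card E \<le> d"
    using ST S T card_le_sym_Diff[of T S] by (auto simp: E_def F_def)
  define t where "t = Min ((\<lambda>n. norm (es n x)) ` A)"
  have t_le: "t \<le> norm (es n x)" if "n \<in> A" for n
    using that finA by (simp add: t_def)
  obtain q where q: "q \<in> A" "t = norm (es q x)"
    using Min_in[of "(\<lambda>n. norm (es n x)) ` A"] finA unfolding t_def by blast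
  have t_ge: "norm (es n x) \<le> t" if "n \<in> {1..} - A" for n
    using that q A by (auto simp: greedy_set_def)
  have t0: "t \<ge> 0" using q by simp
  \<comment> \<open>An index of \<open>A\<close> outside \<open>S\<close> ties the threshold \<open>t\<close> to the residual of \<open>x\<close>.\<close>
  obtain p where "p \<in> A" "p \<notin> S" using False by blast
  then have tR: "t \<le> a * R"
    using t_le[of p] norm_es_le_residual[of S p x] finA S by (force simp: R_def)
  obtain G where G: "finite G" "card G = card E" "G \<subseteq> {1..} - (A \<union> S \<union> T)"
    using infinite_arbitrarily_large[of "{1..} - (A \<union> S \<union> T)" "card E"] finA S T
    by (auto simp: infinite_Ici)
  define J where "J = (\<Sum>n\<in>G. smul (of_real t) (e n))"
  define y where "y = x - P (E \<union> G) x + J"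
  let ?A = "(A - E) \<union> G"
  have G': "G \<subseteq> {1..}" "G \<inter> (A \<union> E) = {}" using G by (auto simp: E_def)
  note repl = greedy_set_replace[OF A(1) finE G(1) G' t0]
  have greedy: "greedy_set es y (card ?A) ?A"
    unfolding y_def J_def using t_le t_ge by (rule repl(1))
  have coord: "es i y = (if i \<in> G then of_real t else if i \<in> E then 0 else es i x)" if "i \<ge> 1" for i
    unfolding y_def J_def using t_le t_ge that by (rule repl(2))
  have "card ?A = card (A - E) + card E"
    using finA G G' by (subst card_Un_disjoint) auto
  then have cardA: "card ?A \<ge> m"
    using diff_card_le_card_Diff[of E A] finE finA by simp
  have PEG: "P (E \<union> G) x = P E x + P G x"
    using finE G(1) G'(2) by (subst sum.union_disjoint) auto
  have PAy: "P ?A y = P (A - E) x + J"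
  proof -
    have "P ?A y = P (A - E) y + P G y"
      using finA(1) G(1) G'(2) by (subst sum.union_disjoint) auto
    moreover have "P (A - E) y = P (A - E) x"
      using finA(2) G'(2) by (intro sum.cong) (auto simp: coord subset_iff)
    moreover have "P G y = J"
      unfolding J_def using G'(1) by (intro sum.cong) (auto simp: coord subset_iff)
    ultimately show ?thesis by simp
  qed
  have PTy: "P T y = P T x"
    using T(2) G(3) by (intro sum.cong) (auto simp: coord subset_iff E_def)
  have sum_split_union: "P (B \<union> D) x = P B x + P (D - B) x" if "finite B" "finite D" for B D
    using that sum.union_disjoint[of B "D - B" "\<lambda>n. smul (es n x) (e n)"] by simp
  have AE: "P E x + P (A - E) x = P A x + P (E - A) x"
    using sum_split_union[OF finE(1) finA(1)] sum_split_union[OF finA(1) finE(1)]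
    by (metis (no_types, lifting) Un_commute)
  have ET: "P E x + P T x = P S x + P F x"
    using sum_split_union[OF S(1) T(1)] sum_split_union[OF T(1) S(1)]
    unfolding E_def F_def by (metis (no_types, lifting) Un_commute add.commute)
  have b: "norm (P B x) \<le> real d * a\<^sup>2 * R" if "B \<subseteq> {1..}" "card B \<le> d"
    "\<And>n. n \<in> B \<Longrightarrow> norm (es n x) \<le> a * R" for B
  proof -
    have "norm (P B x) \<le> real (card B) * (a * R * a)"
      using that by (intro norm_combination_le) auto
    also have "\<dots> \<le> real d * (a * R * a)"
      using that a_nonneg by (intro mult_right_mono) (auto simp: R_def)
    finally show ?thesis by (simp add: power2_eq_square mult_ac)
  qed
  have outside: "norm (es n x) \<le> a * R" if "n \<in> {1..} - A" for n
    using t_ge[OF that] tR by (rule order_trans)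
  have bG: "norm (P G x) \<le> real d * a\<^sup>2 * R"
    using G cardE outside by (intro b) auto
  have bE: "norm (P (E - A) x) \<le> real d * a\<^sup>2 * R"
  proof (intro b)
    show "card (E - A) \<le> d" using card_mono[of E "E - A"] finE cardE by auto
  qed (use finE outside in auto)
  have bF: "norm (P F x) \<le> real d * a\<^sup>2 * R"
  proof (intro b)
    fix n assume "n \<in> F"
    then show "norm (es n x) \<le> a * R"
      unfolding R_def using finF S by (intro norm_es_le_residual) (auto simp: F_def)
  qed (use finF cardF in auto)
  have bJ: "norm J \<le> real d * a\<^sup>2 * R"
  proof -
    have "norm J \<le> real (card G) * (a * R * a)"
      unfolding J_def using G' tR t0 by (intro norm_combination_le) auto
    also have "\<dots> \<le> real d * (a * R * a)"
      using G cardE a_nonneg by (intro mult_right_mono) (auto simp: R_def)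
    finally show ?thesis by (simp add: power2_eq_square mult_ac)
  qed
  have residual: "x - P A x = (y - P ?A y) + P (E - A) x + P G x"
    using AE unfolding PAy unfolding y_def PEG by (simp add: algebra_simps)
  have "norm (x - P A x) \<le> norm (y - P ?A y) + norm (P (E - A) x) + norm (P G x)"
    unfolding residual
    using norm_triangle_ineq[of "(y - P ?A y) + P (E - A) x" "P G x"]
      norm_triangle_ineq[of "y - P ?A y" "P (E - A) x"] by linarith
  moreover have "norm (y - P ?A y) \<le> C * norm (y - P T y)"
    using bound[OF greedy] cardA A ST by simp
  moreover have "norm (y - P T y) \<le> R + 3 * (real d * a\<^sup>2 * R)"
  proof -
    have split: "y - P T y = (x - P S x) - P F x - P G x + J"
      using ET unfolding PTy unfolding y_def PEG by (simp add: algebra_simps)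
    have "norm (y - P T y) \<le> R + norm (P F x) + norm (P G x) + norm J"
      unfolding split R_def
      using norm_triangle_ineq[of "(x - P S x) - P F x - P G x" J]
        norm_triangle_ineq4[of "(x - P S x) - P F x" "P G x"]
        norm_triangle_ineq4[of "x - P S x" "P F x"]
      by linarith
    with bF bG bJ show ?thesis by linarith
  qed
  then have "C * norm (y - P T y) \<le> C * (R + 3 * (real d * a\<^sup>2 * R))"
    using C by (rule mult_left_mono)
  ultimately have "norm (x - P A x) \<le> C * (R + 3 * (real d * a\<^sup>2 * R)) + 2 * (real d * a\<^sup>2 * R)"
    using bE bG by linarith
  also have "\<dots> \<le> R + (C * (R + 3 * (real d * a\<^sup>2 * R)) + 2 * (real d * a\<^sup>2 * R))"
    by (simp add: R_def)
  finally show ?thesis by (simp add: R_def algebra_simps)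
qed

lemma strong_partially_greedy_transfer:
  fixes ms ns :: "nat \<Rightarrow> nat"
  assumes ms: "increasing_pos_seq ms" and ns: "increasing_pos_seq ns"
    and fin: "finite (difference_set ms ns)"
    and spg: "\<exists>C\<ge>1. \<forall>x. \<forall>m\<ge>1. \<forall>A. greedy_set es x m A \<longrightarrow>
      (\<forall>k\<le>m. norm (x - P A x) \<le> C * norm (x - P (ns ` {1..k}) x))"
  shows "\<exists>C\<ge>1. \<forall>x. \<forall>m\<ge>1. \<forall>A. greedy_set es x m A \<longrightarrow>
      (\<forall>k\<le>m. norm (x - P A x) \<le> C * norm (x - P (ms ` {1..k}) x))"
proof -
  obtain C where C: "C \<ge> 1" "\<And>x m A k. m \<ge> 1 \<Longrightarrow> greedy_set es x m A \<Longrightarrow> k \<le> m \<Longrightarrow>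
      norm (x - P A x) \<le> C * norm (x - P (ns ` {1..k}) x)"
    using spg by blast
  define d where "d = card (difference_set ms ns)"
  have "norm (x - P A x)
      \<le> (1 + C * (1 + 3 * real d * a\<^sup>2) + 2 * real d * a\<^sup>2) * norm (x - P (ms ` {1..k}) x)"
    if "m \<ge> 1" "greedy_set es x m A" "k \<le> m" for x m A k
  proof (rule greedy_bound_transfer)
    show "card (ms ` {1..k} - ns ` {1..k}) \<le> d"
      unfolding d_def using assms by (intro card_initial_segment_diff_le)
    show "norm (y - P B y) \<le> C * norm (y - P (ns ` {1..k}) y)"
      if "greedy_set es y l B" "l \<ge> 1" "card (ns ` {1..k}) \<le> l" for y l B
      by (rule C(2)[OF that(2,1) that(3)[unfolded card_initial_segment[OF ns]]])
    show "card (ms ` {1..k}) = card (ns ` {1..k})" "card (ms ` {1..k}) \<le> m"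
      using that(3) by (simp_all only: card_initial_segment ms ns)
  qed (use that C ms ns in \<open>auto simp: increasing_pos_seq_def\<close>)
  moreover have "1 + C * (1 + 3 * real d * a\<^sup>2) + 2 * real d * a\<^sup>2 \<ge> 1"
    using C(1) by simp
  ultimately show ?thesis by blast
qed

end

section \<open>Application to bases of Banach spaces\<close>

lemma is_basis_imp_bounded_biorthogonal:
  assumes "banach_over smul" "is_basis smul e es"
  shows "\<exists>a. bounded_biorthogonal smul e es a"
proof -
  interpret banach_over smul by fact
  obtain a where a: "\<And>n. n \<ge> 1 \<Longrightarrow> norm (e n) \<le> a" "\<And>n. n \<ge> 1 \<Longrightarrow> onorm (es n) \<le> a"
    using assms(2) unfolding is_basis_def bdd_above_def Let_def by fastforce
  have bl: "bounded_linear (es n)" and sm: "es n (smul c x) = c * es n x" if "n \<ge> 1" for n c x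
    using that assms(2) by (auto simp: is_basis_def dual_def)
  have "bounded_biorthogonal smul e es a"
  proof
    show "norm (es n x) \<le> a * norm x" if "n \<ge> 1" for n x
      using onorm[OF bl[OF that], of x] a(2)[OF that]
      by (meson mult_right_mono norm_ge_zero order_trans)
    show "es n (x + y) = es n x + es n y" if "n \<ge> 1" for n x y
      using bl[OF that] by (simp add: linear_simps)
    show "es j (e k) = (if j = k then 1 else 0)" if "j \<ge> 1" "k \<ge> 1" for j k
      using that assms(2) by (simp add: is_basis_def)
  qed (simp_all add: norm_scale sm a)
  then show ?thesis ..
qed

theorem theorem3p9:
  fixes smul :: "'k::real_normed_field \<Rightarrow> 'a::banach \<Rightarrow> 'a"
    and e :: "nat \<Rightarrow> 'a" and es :: "nat \<Rightarrow> 'a \<Rightarrow> 'k"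
    and ms ns :: "nat \<Rightarrow> nat"
  assumes "banach_over smul"
    and "is_basis smul e es"
    and "increasing_pos_seq ms" and "increasing_pos_seq ns"
    and "finite (difference_set ms ns)"
  shows "strong_partially_greedy smul e es ns \<longleftrightarrow> strong_partially_greedy smul e es ms"
proof -
  obtain a where "bounded_biorthogonal smul e es a"
    using is_basis_imp_bounded_biorthogonal assms(1,2) by blast
  then interpret bounded_biorthogonal smul e es a .
  have "difference_set ns ms = difference_set ms ns"
    by (auto simp: difference_set_def)
  then have fin: "finite (difference_set ns ms)"
    using assms(5) by simp
  show ?thesis
    unfolding strong_partially_greedy_iff[OF assms(3)] strong_partially_greedy_iff[OF assms(4)]
      coord_proj_def
    by (rule iffI[OF strong_partially_greedy_transfer[OF assms(3,4,5)]
          strong_partially_greedy_transfer[OF assms(4,3) fin]])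
qed

end
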